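(* Let $m$ be a positive integer. If a unilateral weighted shift $W_\omega$ is subnormal and if $W_\omega^m$ is a direct sum of recursively generated weighted shifts, then $W_\omega$ is a recursively generated weighted shift.
   Context: A unilateral weighted shift $W_\omega$ with bounded positive weights $\omega=\{\omega_n\}_{n\ge0}$ acts on $\ell^2(\mathbb{Z}_+)$ by $W_\omega e_n=\omega_ne_{n+1}$; its moments are $\gamma_0=1$, $\gamma_k=\omega_0^2\cdots\omega_{k-1}^2$ ($k\ge1$). $W_\omega$ is subnormal iff there is a probability measure $\sigma$ on $[0,\|W_\omega\|^2]$ (its Berger measure) with $\gamma_k=\int r^kd\sigma(r)$ for all $k\ge0$. A subnormal unilateral weighted shift is recursively generated if there exist an integer $k\ge1$ and real coefficients $\varphi_0,\dots,\varphi_{k-1}$ such that $\gamma_{n+k}=\varphi_0\gamma_n+\varphi_1\gamma_{n+1}+\cdots+\varphi_{k-1}\gamma_{n+k-1}$ for all $n\ge0$; equivalently, if its Berger measure is finitely atomic. Direct sums are orthogonal direct sums, up to unitary equivalence. For every $m\ge1$, $W_\omega^m$ is unitarily equivalent to $\bigoplus_{i=0}^{m-1}W_{\omega(m:i)}$, where $W_{\omega(m:i)}$ is the unilateral weighted shift with weights $\omega_{mk+i}\,\omega_{mk+i+1}\cdots\omega_{mk+i+m-1}$, $k\ge0$. *)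

theory Defs
  imports "HOL-Probability.Probability"
begin

section \<open>The complex Hilbert space of square-summable families\<close>

definition square_summable :: "('a \<Rightarrow> complex) \<Rightarrow> bool"
  where "square_summable f \<longleftrightarrow> (\<lambda>i. (cmod (f i))\<^sup>2) summable_on UNIV"

lemma square_summable_zero: "square_summable (\<lambda>_. 0)"
  by (simp add: square_summable_def)

lemma square_summable_bound:
  assumes "square_summable f" and "\<And>i. cmod (g i) \<le> C * cmod (f i)"
  shows "square_summable g"
proof -
  have "(\<lambda>i. C\<^sup>2 * (cmod (f i))\<^sup>2) summable_on UNIV"
    using assms(1) unfolding square_summable_def by (rule summable_on_cmult_right)
  moreover have "(cmod (g i))\<^sup>2 \<le> C\<^sup>2 * (cmod (f i))\<^sup>2" for i
    using power_mono[OF assms(2)[of i], of 2] by (simp add: power_mult_distrib)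
  ultimately show ?thesis
    unfolding square_summable_def by (rule summable_on_comparison_test) auto
qed

lemma square_summable_add:
  assumes "square_summable f" and "square_summable g"
  shows "square_summable (\<lambda>i. f i + g i)"
proof -
  have "(\<lambda>i. 2 * (cmod (f i))\<^sup>2 + 2 * (cmod (g i))\<^sup>2) summable_on UNIV"
    using assms unfolding square_summable_def
    by (intro summable_on_add summable_on_cmult_right)
  moreover have "(cmod (f i + g i))\<^sup>2 \<le> 2 * (cmod (f i))\<^sup>2 + 2 * (cmod (g i))\<^sup>2" for i
  proof -
    have "(cmod (f i + g i))\<^sup>2 \<le> (cmod (f i) + cmod (g i))\<^sup>2"
      by (intro power_mono norm_triangle_ineq) simp
    also have "\<dots> \<le> 2 * (cmod (f i))\<^sup>2 + 2 * (cmod (g i))\<^sup>2"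
      using sum_squares_bound[of "cmod (f i)" "cmod (g i)"]
      by (simp add: power2_sum)
    finally show ?thesis .
  qed
  ultimately show ?thesis
    unfolding square_summable_def by (rule summable_on_comparison_test) auto
qed

lemma square_summable_mult:
  assumes "square_summable f" and "square_summable g"
  shows "(\<lambda>i. f i * cnj (g i)) summable_on UNIV"
proof -
  have "(\<lambda>i. (cmod (f i))\<^sup>2 + (cmod (g i))\<^sup>2) summable_on UNIV"
    using assms unfolding square_summable_def by (rule summable_on_add)
  moreover have "norm (f i * cnj (g i)) \<le> (cmod (f i))\<^sup>2 + (cmod (g i))\<^sup>2" for i
  proof -
    have "0 \<le> cmod (f i) * cmod (g i)" by simp
    then show ?thesis
      using sum_squares_bound[of "cmod (f i)" "cmod (g i)"]
      unfolding norm_mult complex_mod_cnj by linarith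
  qed
  ultimately have "(\<lambda>i. norm (f i * cnj (g i))) summable_on UNIV"
    by (rule summable_on_comparison_test) auto
  then show ?thesis by (rule abs_summable_summable)
qed

typedef 'a ell2 = "{f :: 'a \<Rightarrow> complex. square_summable f}"
  morphisms coord Abs_ell2
  using square_summable_zero by blast

setup_lifting type_definition_ell2

lemma square_summable_coord: "square_summable (coord x)"
  using coord[of x] by simp

lemma ell2_eqI: "(\<And>i. coord x i = coord y i) \<Longrightarrow> x = y"
  by (metis coord_inject ext)

lift_definition scaleC_ell2 :: "complex \<Rightarrow> 'a ell2 \<Rightarrow> 'a ell2" is "\<lambda>c f i. c * f i"
  using square_summable_bound by (metis norm_mult order_refl)

text \<open>The inner product is linear in its first argument.\<close>

definition cinner_ell2 :: "'a ell2 \<Rightarrow> 'a ell2 \<Rightarrow> complex"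
  where "cinner_ell2 x y = (\<Sum>\<^sub>\<infinity>i. coord x i * cnj (coord y i))"

instantiation ell2 :: (type) real_inner
begin

lift_definition zero_ell2 :: "'a ell2" is "\<lambda>_. 0"
  by (rule square_summable_zero)

lift_definition plus_ell2 :: "'a ell2 \<Rightarrow> 'a ell2 \<Rightarrow> 'a ell2" is "\<lambda>f g i. f i + g i"
  by (rule square_summable_add)

lift_definition uminus_ell2 :: "'a ell2 \<Rightarrow> 'a ell2" is "\<lambda>f i. - f i"
  by (erule square_summable_bound[where C = 1]) simp

definition minus_ell2 :: "'a ell2 \<Rightarrow> 'a ell2 \<Rightarrow> 'a ell2"
  where "minus_ell2 x y = x + - y"

definition scaleR_ell2 :: "real \<Rightarrow> 'a ell2 \<Rightarrow> 'a ell2"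
  where "scaleR_ell2 r x = scaleC_ell2 (of_real r) x"

definition inner_ell2 :: "'a ell2 \<Rightarrow> 'a ell2 \<Rightarrow> real"
  where "inner_ell2 x y = Re (cinner_ell2 x y)"

definition norm_ell2 :: "'a ell2 \<Rightarrow> real"
  where "norm_ell2 x = sqrt (\<Sum>\<^sub>\<infinity>i. (cmod (coord x i))\<^sup>2)"

definition sgn_ell2 :: "'a ell2 \<Rightarrow> 'a ell2"
  where "sgn_ell2 x = inverse (norm x) *\<^sub>R x"

definition dist_ell2 :: "'a ell2 \<Rightarrow> 'a ell2 \<Rightarrow> real"
  where "dist_ell2 x y = norm (x - y)"

definition uniformity_ell2 :: "('a ell2 \<times> 'a ell2) filter"
  where "uniformity_ell2 = (INF e\<in>{0<..}. principal {(x, y). dist x y < e})"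

definition open_ell2 :: "'a ell2 set \<Rightarrow> bool"
  where "open_ell2 U \<longleftrightarrow> (\<forall>x\<in>U. \<forall>\<^sub>F (x', y) in uniformity. x' = x \<longrightarrow> y \<in> U)"

instance
proof
  fix x y z :: "'a ell2" and r s :: real
  show "x + y + z = x + (y + z)" by transfer (simp add: add.assoc)
  show "x + y = y + x" by transfer (simp add: add.commute)
  show "0 + x = x" by transfer simp
  show "- x + x = 0" by transfer simp
  show "x - y = x + - y" by (simp add: minus_ell2_def)
  show "r *\<^sub>R (x + y) = r *\<^sub>R x + r *\<^sub>R y"
    unfolding scaleR_ell2_def by transfer (simp add: algebra_simps)
  show "(r + s) *\<^sub>R x = r *\<^sub>R x + s *\<^sub>R x"
    unfolding scaleR_ell2_def by transfer (simp add: algebra_simps)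
  show "r *\<^sub>R s *\<^sub>R x = (r * s) *\<^sub>R x"
    unfolding scaleR_ell2_def by transfer (simp add: algebra_simps)
  show "1 *\<^sub>R x = x"
    unfolding scaleR_ell2_def by transfer simp
  show "sgn x = inverse (norm x) *\<^sub>R x" by (rule sgn_ell2_def)
  show "dist x y = norm (x - y)" by (rule dist_ell2_def)
  show "(uniformity :: ('a ell2 \<times> 'a ell2) filter)
      = (INF e\<in>{0<..}. principal {(x, y). dist x y < e})"
    by (rule uniformity_ell2_def)
  show "open U \<longleftrightarrow> (\<forall>x\<in>U. \<forall>\<^sub>F (x', y) in uniformity. x' = x \<longrightarrow> y \<in> U)" for U :: "'a ell2 set"
    by (rule open_ell2_def)
  note [simp] = square_summable_mult[OF square_summable_coord square_summable_coord]
  have norm2: "x \<bullet> x = (\<Sum>\<^sub>\<infinity>i. (cmod (coord x i))\<^sup>2)" for x :: "'a ell2"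
  proof -
    have "cinner_ell2 x x = (\<Sum>\<^sub>\<infinity>i. complex_of_real ((cmod (coord x i))\<^sup>2))"
      unfolding cinner_ell2_def by (simp only: complex_norm_square)
    also have "\<dots> = of_real (\<Sum>\<^sub>\<infinity>i. (cmod (coord x i))\<^sup>2)"
      using square_summable_coord[of x] unfolding square_summable_def
      by (intro infsumI has_sum_of_real has_sum_infsum)
    finally show ?thesis by (simp add: inner_ell2_def)
  qed
  have "cinner_ell2 x y = cnj (cinner_ell2 y x)"
    unfolding cinner_ell2_def by (simp add: mult.commute flip: infsum_cnj)
  then show "x \<bullet> y = y \<bullet> x" by (simp add: inner_ell2_def)
  have "cinner_ell2 (x + y) z = cinner_ell2 x z + cinner_ell2 y z"
    unfolding cinner_ell2_def by (simp add: plus_ell2.rep_eq distrib_right infsum_add)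
  then show "(x + y) \<bullet> z = x \<bullet> z + y \<bullet> z" by (simp add: inner_ell2_def)
  have "cinner_ell2 (r *\<^sub>R x) y = of_real r * cinner_ell2 x y"
    unfolding cinner_ell2_def scaleR_ell2_def
    by (simp add: scaleC_ell2.rep_eq mult.assoc infsum_cmult_right)
  then show "(r *\<^sub>R x) \<bullet> y = r * (x \<bullet> y)" by (simp add: inner_ell2_def)
  show "0 \<le> x \<bullet> x" unfolding norm2 by (rule infsum_nonneg) simp
  show "norm x = sqrt (x \<bullet> x)" unfolding norm2 by (rule norm_ell2_def)
  show "x \<bullet> x = 0 \<longleftrightarrow> x = 0"
  proof
    assume "x \<bullet> x = 0"
    then have "(cmod (coord x i))\<^sup>2 = 0" for i
      unfolding norm2
      using nonneg_infsum_le_0D[of "\<lambda>i. (cmod (coord x i))\<^sup>2" UNIV i]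
        square_summable_coord[of x]
      by (simp add: square_summable_def)
    then show "x = 0" by (intro ell2_eqI) (simp add: zero_ell2.rep_eq)
  qed (simp add: norm2 zero_ell2.rep_eq)
qed

end

definition unitary :: "('a ell2 \<Rightarrow> 'b ell2) \<Rightarrow> bool"
  where "unitary U \<longleftrightarrow>
    (\<forall>x y. U (x + y) = U x + U y) \<and> (\<forall>c x. U (scaleC_ell2 c x) = scaleC_ell2 c (U x)) \<and>
    (\<forall>x y. cinner_ell2 (U x) (U y) = cinner_ell2 x y) \<and> surj U"

definition unitarily_equivalent :: "('a ell2 \<Rightarrow> 'a ell2) \<Rightarrow> ('b ell2 \<Rightarrow> 'b ell2) \<Rightarrow> bool"
  where "unitarily_equivalent S T \<longleftrightarrow> (\<exists>U. unitary U \<and> (\<forall>x. U (S x) = T (U x)))"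

section \<open>Orthogonal direct sums\<close>

text \<open>
  The orthogonal direct sum of copies of \<open>\<ell>\<^sup>2('a)\<close> indexed by \<open>'j\<close> is \<open>\<ell>\<^sup>2('j \<times> 'a)\<close>; its
  \<open>j\<close>-th component is the restriction of a family to \<open>{j} \<times> 'a\<close>.
\<close>

lift_definition component :: "'j \<Rightarrow> ('j \<times> 'a) ell2 \<Rightarrow> 'a ell2" is "\<lambda>j f a. f (j, a)"
proof -
  fix j :: 'j and f :: "'j \<times> 'a \<Rightarrow> complex"
  assume "square_summable f"
  then have "(\<lambda>p. (cmod (f p))\<^sup>2) summable_on range (Pair j)"
    unfolding square_summable_def by (rule summable_on_subset_banach) simp
  moreover have "inj (Pair j :: 'a \<Rightarrow> _)" by (simp add: inj_on_def)
  ultimately show "square_summable (\<lambda>a. f (j, a))"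
    by (simp add: summable_on_reindex o_def square_summable_def)
qed

text \<open>
  For bounded operators \<open>T j\<close>, an operator \<open>S\<close> as below exists iff the \<open>T j\<close> are uniformly
  bounded, i.e. iff their direct sum is a bounded operator, and then \<open>S\<close> is unique.
\<close>

definition is_direct_sum ::
    "(('j \<times> 'a) ell2 \<Rightarrow> ('j \<times> 'a) ell2) \<Rightarrow> ('j \<Rightarrow> 'a ell2 \<Rightarrow> 'a ell2) \<Rightarrow> bool"
  where "is_direct_sum S T \<longleftrightarrow> (\<forall>j x. component j (S x) = T j (component j x))"

section \<open>Unilateral weighted shifts\<close>

definition shift_weights :: "(nat \<Rightarrow> real) \<Rightarrow> bool"
  where "shift_weights \<omega> \<longleftrightarrow> (\<forall>n. 0 < \<omega> n) \<and> bounded (range \<omega>)"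

text \<open>
  For unbounded \<open>\<omega>\<close> the value is unspecified; for bounded \<open>\<omega>\<close> see \<open>coord_weighted_shift\<close>.
\<close>

definition weighted_shift :: "(nat \<Rightarrow> real) \<Rightarrow> nat ell2 \<Rightarrow> nat ell2"
  where "weighted_shift \<omega> x =
    Abs_ell2 (\<lambda>n. case n of 0 \<Rightarrow> 0 | Suc k \<Rightarrow> of_real (\<omega> k) * coord x k)"

lift_definition basis_vector :: "'a \<Rightarrow> 'a ell2" is "\<lambda>a i. if i = a then 1 else 0"
  unfolding square_summable_def by (rule finite_nonzero_values_imp_summable_on) simp

lemma square_summable_weighted_shift:
  assumes "\<And>n. \<bar>\<omega> n\<bar> \<le> C"
  shows "square_summable (\<lambda>n. case n of 0 \<Rightarrow> 0 | Suc k \<Rightarrow> of_real (\<omega> k) * coord x k)"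
    (is "square_summable ?g")
proof -
  have "square_summable (\<lambda>k. of_real (\<omega> k) * coord x k)"
    by (rule square_summable_bound[OF square_summable_coord[of x], of _ C])
      (simp add: norm_mult mult_right_mono assms)
  then have "(\<lambda>n. (cmod (?g n))\<^sup>2) summable_on range Suc"
    by (simp add: summable_on_reindex o_def square_summable_def)
  moreover have "(\<lambda>n. (cmod (?g n))\<^sup>2) summable_on range Suc \<longleftrightarrow>
      (\<lambda>n. (cmod (?g n))\<^sup>2) summable_on UNIV"
    by (rule summable_on_cong_neutral) (auto split: nat.split)
  ultimately show ?thesis
    by (simp add: square_summable_def)
qed

lemma coord_weighted_shift:
  assumes "bounded (range \<omega>)"
  shows "coord (weighted_shift \<omega> x) n = (case n of 0 \<Rightarrow> 0 | Suc k \<Rightarrow> of_real (\<omega> k) * coord x k)"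
proof -
  obtain C where "\<And>n. \<bar>\<omega> n\<bar> \<le> C"
    using assms by (auto simp: bounded_iff)
  from square_summable_weighted_shift[OF this, where x = x] show ?thesis
    by (simp add: weighted_shift_def Abs_ell2_inverse)
qed

lemma weighted_shift_basis_vector:
  assumes "bounded (range \<omega>)"
  shows "weighted_shift \<omega> (basis_vector n) = \<omega> n *\<^sub>R basis_vector (Suc n)"
  by (rule ell2_eqI)
    (simp add: coord_weighted_shift[OF assms] basis_vector.rep_eq scaleR_ell2_def
      scaleC_ell2.rep_eq split: nat.split)

lemma bounded_linear_weighted_shift:
  assumes "bounded (range \<omega>)"
  shows "bounded_linear (weighted_shift \<omega>)"
proof -
  note cw = coord_weighted_shift[OF assms]
  obtain C where C: "\<And>n. \<bar>\<omega> n\<bar> \<le> C"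
    using assms by (auto simp: bounded_iff)
  show ?thesis
  proof (rule bounded_linear_intro[where K = C])
    show "weighted_shift \<omega> (x + y) = weighted_shift \<omega> x + weighted_shift \<omega> y" for x y
      by (rule ell2_eqI) (simp add: cw plus_ell2.rep_eq algebra_simps split: nat.split)
    show "weighted_shift \<omega> (r *\<^sub>R x) = r *\<^sub>R weighted_shift \<omega> x" for r x
      by (rule ell2_eqI)
        (simp add: cw scaleR_ell2_def scaleC_ell2.rep_eq algebra_simps split: nat.split)
    show "norm (weighted_shift \<omega> x) \<le> norm x * C" for x
    proof -
      have C0: "0 \<le> C" using C[of 0] by linarith
      have "(\<Sum>\<^sub>\<infinity>n. (cmod (coord (weighted_shift \<omega> x) n))\<^sup>2)
          = (\<Sum>\<^sub>\<infinity>n\<in>range Suc. (cmod (coord (weighted_shift \<omega> x) n))\<^sup>2)"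
        by (rule infsum_cong_neutral) (auto simp: cw split: nat.split)
      also have "\<dots> = (\<Sum>\<^sub>\<infinity>k. (cmod (\<omega> k * coord x k))\<^sup>2)"
        by (simp add: infsum_reindex o_def cw)
      also have "\<dots> \<le> (\<Sum>\<^sub>\<infinity>k. C\<^sup>2 * (cmod (coord x k))\<^sup>2)"
      proof (rule infsum_mono)
        show "(\<lambda>k. C\<^sup>2 * (cmod (coord x k))\<^sup>2) summable_on UNIV"
          using square_summable_coord[of x] unfolding square_summable_def
          by (rule summable_on_cmult_right)
        have "square_summable (\<lambda>k. of_real (\<omega> k) * coord x k)"
          by (rule square_summable_bound[OF square_summable_coord[of x], of _ C])
            (simp add: norm_mult mult_right_mono C)
        then show "(\<lambda>k. (cmod (\<omega> k * coord x k))\<^sup>2) summable_on UNIV"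
          by (simp add: square_summable_def)
        show "(cmod (\<omega> k * coord x k))\<^sup>2 \<le> C\<^sup>2 * (cmod (coord x k))\<^sup>2" for k
          using power_mono[OF mult_right_mono[OF C[of k] norm_ge_zero[of "coord x k"]], of 2]
          by (simp add: norm_mult power_mult_distrib)
      qed
      also have "\<dots> = C\<^sup>2 * (\<Sum>\<^sub>\<infinity>k. (cmod (coord x k))\<^sup>2)"
        using square_summable_coord[of x] unfolding square_summable_def
        by (intro infsum_cmult_right)
      finally have "norm (weighted_shift \<omega> x) \<le> sqrt (C\<^sup>2 * (\<Sum>\<^sub>\<infinity>k. (cmod (coord x k))\<^sup>2))"
        unfolding norm_ell2_def by (rule real_sqrt_le_mono)
      then show ?thesis using C0
        by (simp add: norm_ell2_def real_sqrt_mult mult.commute)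
    qed
  qed
qed

definition moment :: "(nat \<Rightarrow> real) \<Rightarrow> nat \<Rightarrow> real"
  where "moment \<omega> k = (\<Prod>i<k. (\<omega> i)\<^sup>2)"

definition Berger_measure :: "(nat \<Rightarrow> real) \<Rightarrow> real measure \<Rightarrow> bool"
  where "Berger_measure \<omega> \<sigma> \<longleftrightarrow>
    prob_space \<sigma> \<and>
    sets \<sigma> = sets (restrict_space borel {0..(onorm (weighted_shift \<omega>))\<^sup>2}) \<and>
    (\<forall>k. moment \<omega> k = (LINT r|\<sigma>. r ^ k))"

text \<open>
  Subnormality of a weighted shift, in Berger's form: the moments are those of a probability
  measure on \<open>[0, \<parallel>W\<parallel>\<^sup>2]\<close>.
\<close>

definition subnormal_shift :: "(nat \<Rightarrow> real) \<Rightarrow> bool"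
  where "subnormal_shift \<omega> \<longleftrightarrow> shift_weights \<omega> \<and> (\<exists>\<sigma>. Berger_measure \<omega> \<sigma>)"

definition recursively_generated_shift :: "(nat \<Rightarrow> real) \<Rightarrow> bool"
  where "recursively_generated_shift \<omega> \<longleftrightarrow>
    subnormal_shift \<omega> \<and>
    (\<exists>k\<ge>1. \<exists>\<phi>. \<forall>n. moment \<omega> (n + k) = (\<Sum>i<k. \<phi> i * moment \<omega> (n + i)))"

end

theory Submission
  imports Defs
begin

text \<open>
  Write \<open>W\<close> for the shift with weights \<open>\<omega>\<close>, \<open>\<gamma>\<close> for its moments, \<open>\<sigma>\<close> for its Berger measure and
  \<open>U\<close> for a unitary with \<open>U W\<^sup>m = S U\<close>. A recurrence for the moments of one well-chosen summand of \<open>S\<close>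
  forces one for \<open>\<gamma>\<close>.

  The vector \<open>e\<^sub>0\<close> is orthogonal to the range of \<open>W\<^sup>m\<close>, so \<open>U e\<^sub>0\<close> is a nonzero vector orthogonal to
  the range of \<open>S\<close>. Such a vector lives on the coordinates \<open>(j, 0)\<close>, hence \<open>U e\<^sub>0\<close> is not orthogonal
  to \<open>e\<^sub>(\<^sub>j\<^sub>,\<^sub>0\<^sub>)\<close> for some \<open>j\<close>. Put \<open>v = U\<^sup>-\<^sup>1 e\<^sub>(\<^sub>j\<^sub>,\<^sub>0\<^sub>)\<close>. It is orthogonal to the range of \<open>W\<^sup>m\<close>, that is,
  supported on \<open>{0, ..., m - 1}\<close>, and its coordinate \<open>v\<^sub>0\<close> is nonzero. Comparing the norms of
  \<open>S\<^sup>n e\<^sub>(\<^sub>j\<^sub>,\<^sub>0\<^sub>)\<close> and \<open>W\<^sup>m\<^sup>n v\<close> expresses the moments of the \<open>j\<close>-th summand as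
  \<open>\<Sum>i<m. (\<bar>v\<^sub>i\<bar>\<^sup>2 / \<gamma>\<^sub>i) \<gamma>\<^bsub>i + mn\<^esub> = \<integral> h(r) (r\<^sup>m)\<^sup>n d\<sigma>(r)\<close>, where \<open>h(r) = \<Sum>i<m. (\<bar>v\<^sub>i\<bar>\<^sup>2 / \<gamma>\<^sub>i) r\<^sup>i\<close> is
  bounded below by \<open>\<bar>v\<^sub>0\<bar>\<^sup>2 > 0\<close> on the support of \<open>\<sigma>\<close> (lemma \<open>summand_moments\<close>).

  Let \<open>p\<close> be the monic polynomial of a recurrence for these moments. The recurrence says that
  \<open>\<integral> h(r) p(r\<^sup>m) (r\<^sup>m)\<^sup>n d\<sigma>(r) = 0\<close> for all \<open>n\<close>, so \<open>\<integral> h(r) p(r\<^sup>m)\<^sup>2 d\<sigma>(r) = 0\<close>. By positivity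
  \<open>p(r\<^sup>m)\<close> vanishes \<open>\<sigma>\<close>-almost everywhere, and integrating \<open>p(r\<^sup>m) r\<^sup>n\<close> gives a recurrence for \<open>\<gamma>\<close>
  (lemma \<open>moments_recurrence_lift\<close>).
\<close>

section \<open>Coordinates and inner products\<close>

lemma cinner_finite_support:
  assumes "finite F" and "\<And>i. i \<notin> F \<Longrightarrow> coord x i = 0"
  shows "cinner_ell2 x y = (\<Sum>i\<in>F. coord x i * cnj (coord y i))"
proof -
  have "cinner_ell2 x y = (\<Sum>\<^sub>\<infinity>i\<in>F. coord x i * cnj (coord y i))"
    unfolding cinner_ell2_def by (rule infsum_cong_neutral) (auto simp: assms(2))
  with assms(1) show ?thesis by simp
qed

lemma cinner_basis_vector_left: "cinner_ell2 (basis_vector a) x = cnj (coord x a)"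
  by (subst cinner_finite_support[of "{a}"]) (auto simp: basis_vector.rep_eq)

lemma cinner_commute: "cinner_ell2 x y = cnj (cinner_ell2 y x)"
  unfolding cinner_ell2_def by (simp add: mult.commute flip: infsum_cnj)

lemma cinner_basis_vector_right: "cinner_ell2 x (basis_vector a) = coord x a"
  by (subst cinner_commute) (simp add: cinner_basis_vector_left)

section \<open>Powers of weighted shifts and of their direct sums\<close>

lemma coord_weighted_shift_funpow:
  assumes "bounded (range \<omega>)"
  shows "coord ((weighted_shift \<omega> ^^ p) x) n =
    (if n < p then 0 else of_real (\<Prod>l<p. \<omega> (n - p + l)) * coord x (n - p))"
  by (induction p arbitrary: n) (auto simp: coord_weighted_shift[OF assms] split: nat.split)

lemma moment_add: "moment \<omega> (i + p) = moment \<omega> i * (\<Prod>l<p. (\<omega> (i + l))\<^sup>2)"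
  by (induction p) (simp_all add: moment_def)

lemma moment_pos: "shift_weights \<omega> \<Longrightarrow> 0 < moment \<omega> k"
  unfolding moment_def shift_weights_def by (intro prod_pos) (simp add: less_imp_neq[symmetric])

lemma cinner_weighted_shift_funpow:
  assumes \<omega>: "shift_weights \<omega>" and v: "\<And>n. m \<le> n \<Longrightarrow> coord v n = 0"
  shows "cinner_ell2 ((weighted_shift \<omega> ^^ p) v) ((weighted_shift \<omega> ^^ p) v) =
    of_real (\<Sum>i<m. (cmod (coord v i))\<^sup>2 / moment \<omega> i * moment \<omega> (i + p))"
proof -
  have b: "bounded (range \<omega>)" using \<omega> by (simp add: shift_weights_def)
  let ?x = "(weighted_shift \<omega> ^^ p) v"
  have "cinner_ell2 ?x ?x = (\<Sum>n\<in>(\<lambda>i. i + p) ` {..<m}. coord ?x n * cnj (coord ?x n))"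
  proof (rule cinner_finite_support)
    fix n assume n: "n \<notin> (\<lambda>i. i + p) ` {..<m}"
    then have "n < p \<or> m \<le> n - p"
      by (metis image_eqI le_add_diff_inverse2 lessThan_iff not_less)
    then show "coord ?x n = 0"
      by (auto simp: coord_weighted_shift_funpow[OF b] v)
  qed simp
  also have "\<dots> = (\<Sum>i<m. coord ?x (i + p) * cnj (coord ?x (i + p)))"
    by (subst sum.reindex) (auto simp: inj_on_def)
  also have "\<dots> = (\<Sum>i<m. of_real ((cmod (coord v i))\<^sup>2 / moment \<omega> i * moment \<omega> (i + p)))"
  proof (rule sum.cong)
    fix i
    have "moment \<omega> i \<noteq> 0" using moment_pos[OF \<omega>, of i] by simp
    then have "(cmod (coord v i))\<^sup>2 / moment \<omega> i * moment \<omega> (i + p) =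
        (cmod (coord ?x (i + p)))\<^sup>2"
      by (simp add: coord_weighted_shift_funpow[OF b] moment_add norm_mult
          power_mult_distrib prod_power_distrib flip: of_real_prod)
    then show "coord ?x (i + p) * cnj (coord ?x (i + p)) =
        of_real ((cmod (coord v i))\<^sup>2 / moment \<omega> i * moment \<omega> (i + p))"
      by (simp only: complex_norm_square)
  qed simp
  finally show ?thesis by simp
qed

lemma component_direct_sum_funpow:
  assumes "is_direct_sum S T"
  shows "component j ((S ^^ n) x) = (T j ^^ n) (component j x)"
  using assms by (induction n) (auto simp: is_direct_sum_def)

lemma coord_component: "coord x (j, n) = coord (component j x) n"
  by (simp add: component.rep_eq)

lemma cinner_direct_sum_funpow_basis_vector:
  assumes S: "is_direct_sum S (\<lambda>j. weighted_shift (\<alpha> j))"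
    and \<alpha>: "\<And>j. shift_weights (\<alpha> j)"
  shows "cinner_ell2 ((S ^^ n) (basis_vector (j, 0))) ((S ^^ n) (basis_vector (j, 0))) =
    of_real (moment (\<alpha> j) n)"
proof -
  have b: "bounded (range (\<alpha> j))" for j using \<alpha> by (simp add: shift_weights_def)
  let ?x = "(S ^^ n) (basis_vector (j, 0))"
  have c: "coord ?x (i, k) =
      (if (i, k) = (j, n) then of_real (\<Prod>l<n. \<alpha> j l) else 0)" for i k
    unfolding coord_component component_direct_sum_funpow[OF S]
    by (auto simp: coord_weighted_shift_funpow[OF b] component.rep_eq basis_vector.rep_eq)
  have "cinner_ell2 ?x ?x = coord ?x (j, n) * cnj (coord ?x (j, n))"
    by (subst cinner_finite_support[of "{(j, n)}"]) (auto simp: c split: if_splits)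
  also have "\<dots> = of_real (moment (\<alpha> j) n)"
    by (simp add: c moment_def power2_eq_square prod.distrib)
  finally show ?thesis .
qed

section \<open>The moments of a suitable summand\<close>

lemma unitary_intertwines_funpow:
  assumes "\<And>x. U (A x) = S (U x)"
  shows "U ((A ^^ n) x) = (S ^^ n) (U x)"
  by (induction n) (simp_all add: assms)

text \<open>
  Each \<open>e\<^sub>(\<^sub>j\<^sub>,\<^sub>n\<^sub>+\<^sub>1\<^sub>)\<close> is a multiple of \<open>S e\<^sub>(\<^sub>j\<^sub>,\<^sub>n\<^sub>)\<close>, so orthogonality to the range of \<open>S\<close> kills every
  coordinate except those at \<open>(j, 0)\<close>.
\<close>

lemma orthogonal_range_direct_sum:
  assumes S: "is_direct_sum S (\<lambda>j. weighted_shift (\<alpha> j))"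
    and \<alpha>: "\<And>j. shift_weights (\<alpha> j)"
    and orth: "\<And>x. cinner_ell2 (S x) y = 0"
  shows "coord y (j, Suc n) = 0"
proof -
  have b: "bounded (range (\<alpha> j))" for j using \<alpha> by (simp add: shift_weights_def)
  let ?x = "S (basis_vector (j, n))"
  have c: "coord ?x (i, k) = (if (i, k) = (j, Suc n) then of_real (\<alpha> j n) else 0)" for i k
    using component_direct_sum_funpow[OF S, of i 1 "basis_vector (j, n)"]
    by (auto simp: coord_component coord_weighted_shift[OF b] component.rep_eq
        basis_vector.rep_eq split: nat.split)
  have "cinner_ell2 ?x y = of_real (\<alpha> j n) * cnj (coord y (j, Suc n))"
    by (subst cinner_finite_support[of "{(j, Suc n)}"]) (auto simp: c split: if_splits)
  moreover have "\<alpha> j n \<noteq> 0" using \<alpha>[of j] by (auto simp: shift_weights_def dest: spec[of _ n])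
  ultimately show ?thesis using orth[of "basis_vector (j, n)"] by simp
qed

lemma orthogonal_range_weighted_shift_funpow:
  assumes \<omega>: "shift_weights \<omega>"
    and orth: "\<And>x. cinner_ell2 v ((weighted_shift \<omega> ^^ m) x) = 0"
    and "m \<le> n"
  shows "coord v n = 0"
proof -
  have b: "bounded (range \<omega>)" using \<omega> by (simp add: shift_weights_def)
  let ?c = "\<Prod>l<m. \<omega> (n - m + l)"
  let ?x = "(weighted_shift \<omega> ^^ m) (basis_vector (n - m))"
  have "cinner_ell2 ?x v = of_real ?c * cnj (coord v n)"
    using \<open>m \<le> n\<close>
    by (subst cinner_finite_support[of "{n}"])
      (auto simp: coord_weighted_shift_funpow[OF b] basis_vector.rep_eq)
  moreover have "?c \<noteq> 0"
    using \<omega> by (simp add: shift_weights_def less_imp_neq[symmetric])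
  moreover have "cinner_ell2 ?x v = 0"
    by (subst cinner_commute) (simp add: orth)
  ultimately show ?thesis by (simp del: of_real_prod)
qed

text \<open>
  The weights are \<open>w\<^sub>i = \<bar>v\<^sub>i\<bar>\<^sup>2 / \<gamma>\<^sub>i\<close> for the vector \<open>v = U\<^sup>-\<^sup>1 e\<^sub>(\<^sub>j\<^sub>,\<^sub>0\<^sub>)\<close>. Positivity of \<open>w\<^sub>0\<close> is what
  restricts the choice of \<open>j\<close>: the moments then come from a density
  on the Berger measure of \<open>\<omega>\<close> that vanishes nowhere on its support.
\<close>

lemma summand_moments:
  fixes \<alpha> :: "'j \<Rightarrow> nat \<Rightarrow> real"
  assumes "m \<ge> 1" and \<omega>: "shift_weights \<omega>" and \<alpha>: "\<And>j. shift_weights (\<alpha> j)"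
    and S: "is_direct_sum S (\<lambda>j. weighted_shift (\<alpha> j))"
    and equiv: "unitarily_equivalent (weighted_shift \<omega> ^^ m) S"
  obtains j and w :: "nat \<Rightarrow> real" where "\<And>i. 0 \<le> w i" and "0 < w 0"
    and "\<And>n. moment (\<alpha> j) n = (\<Sum>i<m. w i * moment \<omega> (i + m * n))"
proof -
  have b: "bounded (range \<omega>)" using \<omega> by (simp add: shift_weights_def)
  have b': "bounded (range (\<alpha> j))" for j using \<alpha> by (simp add: shift_weights_def)
  obtain U :: "nat ell2 \<Rightarrow> ('j \<times> nat) ell2"
    where U: "unitary U" and US: "\<And>x. U ((weighted_shift \<omega> ^^ m) x) = S (U x)"
    using equiv by (auto simp: unitarily_equivalent_def)
  have U_cinner: "cinner_ell2 (U x) (U y) = cinner_ell2 x y" for x y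
    using U by (simp add: unitary_def)
  have U_surj: "\<exists>x. U x = y" for y
    using U unfolding unitary_def by (metis surjD)
  define y where "y = U (basis_vector 0)"
  have "cinner_ell2 (S x) y = 0" for x
  proof -
    obtain z where z: "U z = x" using U_surj by blast
    have "cinner_ell2 (S x) y = cinner_ell2 ((weighted_shift \<omega> ^^ m) z) (basis_vector 0)"
      unfolding z[symmetric] y_def US[symmetric] U_cinner ..
    also have "\<dots> = 0"
      using \<open>m \<ge> 1\<close> by (simp add: cinner_basis_vector_right coord_weighted_shift_funpow[OF b])
    finally show ?thesis .
  qed
  then have y_Suc: "coord y (j, Suc n) = 0" for j n
    by (rule orthogonal_range_direct_sum[OF S \<alpha>])
  \<comment> \<open>Otherwise \<open>y = 0\<close>, although \<open>y\<close> is the image of a unit vector.\<close>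
  have "\<exists>j. coord y (j, 0) \<noteq> 0"
  proof (rule ccontr)
    assume "\<not> ?thesis"
    then have "coord y i = 0" for i
      using y_Suc by (metis old.nat.exhaust surj_pair)
    then have "cinner_ell2 y y = 0" by (simp add: cinner_ell2_def)
    then show False
      by (simp add: y_def U_cinner cinner_basis_vector_left basis_vector.rep_eq)
  qed
  then obtain j where j: "coord y (j, 0) \<noteq> 0" by blast
  obtain v where v: "U v = basis_vector (j, 0)" using U_surj by blast
  have v_0: "coord v 0 \<noteq> 0"
  proof -
    have "coord v 0 = cinner_ell2 (U v) y"
      by (simp add: y_def U_cinner cinner_basis_vector_right)
    with j show ?thesis by (simp add: v cinner_basis_vector_left)
  qed
  have "cinner_ell2 v ((weighted_shift \<omega> ^^ m) x) = 0" for x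
  proof -
    have "cinner_ell2 v ((weighted_shift \<omega> ^^ m) x) = cnj (coord (S (U x)) (j, 0))"
      by (simp add: U_cinner[symmetric] v US cinner_basis_vector_left)
    also have "coord (S (U x)) (j, 0) = 0"
      using component_direct_sum_funpow[OF S, of j 1 "U x"]
      by (simp add: coord_component coord_weighted_shift[OF b'])
    finally show ?thesis by simp
  qed
  then have v_supp: "coord v n = 0" if "m \<le> n" for n
    using orthogonal_range_weighted_shift_funpow[OF \<omega>] that by blast
  define w where "w i = (cmod (coord v i))\<^sup>2 / moment \<omega> i" for i
  have w_moments: "moment (\<alpha> j) n = (\<Sum>i<m. w i * moment \<omega> (i + m * n))" for n
  proof -
    let ?x = "(weighted_shift \<omega> ^^ (m * n)) v"
    have "U ?x = (S ^^ n) (basis_vector (j, 0))"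
      using unitary_intertwines_funpow[of U "weighted_shift \<omega> ^^ m" S, OF US, of n v]
      by (simp add: v funpow_mult mult.commute)
    then have "complex_of_real (moment (\<alpha> j) n) = cinner_ell2 ?x ?x"
      using cinner_direct_sum_funpow_basis_vector[OF S \<alpha>, of n j] U_cinner[of ?x ?x] by simp
    also have "\<dots> = of_real (\<Sum>i<m. w i * moment \<omega> (i + m * n))"
      unfolding w_def by (rule cinner_weighted_shift_funpow[OF \<omega> v_supp])
    finally show ?thesis by (simp only: of_real_eq_iff)
  qed
  have w_nonneg: "0 \<le> w i" for i
    using moment_pos[OF \<omega>, of i] by (simp add: w_def)
  have w_pos: "0 < w 0"
    using moment_pos[OF \<omega>, of 0] v_0 by (simp add: w_def)
  show ?thesis by (rule that[OF w_nonneg w_pos w_moments])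
qed

section \<open>Transferring a recurrence\<close>

text \<open>
  The sequence \<open>a\<close> consists of the moments of \<open>h d\<sigma>\<close> under \<open>r \<mapsto> r\<^sup>m\<close>, where the density
  \<open>h(r) = \<Sum>i<m. w\<^sub>i r\<^sup>i\<close> is at least \<open>w\<^sub>0\<close> on the nonnegative half-line. A positive measure whose moments
  satisfy a recurrence is concentrated on the zeros of the characteristic polynomial \<open>p\<close>, because the
  integral of \<open>p\<^sup>2\<close> vanishes; as \<open>h\<close> is positive, \<open>\<sigma>\<close> is concentrated on the zeros of \<open>p(r\<^sup>m)\<close>.
\<close>

lemma moments_recurrence_lift:
  fixes \<sigma> :: "real measure" and \<gamma> :: "nat \<Rightarrow> real"
  assumes nonneg: "\<And>r. r \<in> space \<sigma> \<Longrightarrow> 0 \<le> r"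
    and int: "\<And>k. integrable \<sigma> (\<lambda>r. r ^ k)"
    and \<gamma>: "\<And>k. \<gamma> k = (LINT r|\<sigma>. r ^ k)"
    and m: "m \<ge> 1" and w: "\<And>i. 0 \<le> w i" "0 < w 0"
    and a: "\<And>n. a n = (\<Sum>i<m. w i * \<gamma> (i + m * n))"
    and rec: "\<And>n. a (n + k) = (\<Sum>i<k. \<phi> i * a (n + i))"
  shows "\<gamma> (n + m * k) = (\<Sum>i<k. \<phi> i * \<gamma> (n + m * i))"
proof -
  define h where "h r = (\<Sum>i<m. w i * r ^ i)" for r :: real
  define p where "p t = t ^ k - (\<Sum>i<k. \<phi> i * t ^ i)" for t :: real
  have p_alt: "p (r ^ m) = r ^ (m * k) - (\<Sum>i<k. \<phi> i * r ^ (m * i))" for r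
    by (simp add: p_def power_mult)
  have h_int: "integrable \<sigma> (\<lambda>r. h r * r ^ l)"
    and h_LINT: "(LINT r|\<sigma>. h r * r ^ l) = (\<Sum>i<m. w i * \<gamma> (i + l))" for l
    by (simp_all add: h_def sum_distrib_right mult.assoc int \<gamma> flip: power_add)
  have hp: "h r * p (r ^ m) * r ^ l =
      h r * r ^ (m * k + l) - (\<Sum>i<k. \<phi> i * (h r * r ^ (m * i + l)))" for r l
    by (simp add: p_alt power_add algebra_simps sum_distrib_left)
  have hp_int: "integrable \<sigma> (\<lambda>r. h r * p (r ^ m) * r ^ l)" for l
    unfolding hp by (intro Bochner_Integration.integrable_diff Bochner_Integration.integrable_sum
        integrable_mult_right h_int)
  have hp_LINT: "(LINT r|\<sigma>. h r * p (r ^ m) * r ^ (m * n)) = 0" for n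
  proof -
    have "(LINT r|\<sigma>. h r * p (r ^ m) * r ^ (m * n)) = a (n + k) - (\<Sum>i<k. \<phi> i * a (n + i))"
      unfolding hp
      by (subst Bochner_Integration.integral_diff)
        (auto simp: h_int h_LINT a integral_sum algebra_simps)
    then show ?thesis by (simp add: rec)
  qed
  \<comment> \<open>Expand one of the two factors \<open>p (r ^ m)\<close> in powers of \<open>r ^ m\<close>.\<close>
  have hpp: "h r * (p (r ^ m))\<^sup>2 =
      h r * p (r ^ m) * r ^ (m * k) - (\<Sum>i<k. \<phi> i * (h r * p (r ^ m) * r ^ (m * i)))" for r
  proof -
    have "h r * (p (r ^ m))\<^sup>2 =
        h r * p (r ^ m) * (r ^ (m * k) - (\<Sum>i<k. \<phi> i * r ^ (m * i)))"
      by (simp add: power2_eq_square flip: p_alt)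
    then show ?thesis
      by (simp add: right_diff_distrib sum_distrib_left mult_ac)
  qed
  have hpp_int: "integrable \<sigma> (\<lambda>r. h r * (p (r ^ m))\<^sup>2)"
    unfolding hpp by (intro Bochner_Integration.integrable_diff Bochner_Integration.integrable_sum
        integrable_mult_right hp_int)
  have hpp_LINT: "(LINT r|\<sigma>. h r * (p (r ^ m))\<^sup>2) = 0"
    unfolding hpp by (subst Bochner_Integration.integral_diff)
      (auto simp: hp_int hp_LINT integral_sum)
  have h_pos: "0 < h r" if "r \<in> space \<sigma>" for r
  proof -
    have "w 0 * r ^ 0 \<le> h r"
      unfolding h_def using m w nonneg[OF that]
      by (intro member_le_sum) auto
    with w show ?thesis by simp
  qed
  have "AE r in \<sigma>. h r * (p (r ^ m))\<^sup>2 = 0"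
    using hpp_LINT h_pos
    by (subst integral_nonneg_eq_0_iff_AE[OF hpp_int, symmetric])
      (auto intro!: mult_nonneg_nonneg simp: less_imp_le)
  with AE_space have "AE r in \<sigma>. p (r ^ m) = 0"
    by eventually_elim (use h_pos in force)
  then have "(LINT r|\<sigma>. p (r ^ m) * r ^ n) = 0"
    by (intro integral_eq_zero_AE) auto
  moreover have "p (r ^ m) * r ^ n = r ^ (n + m * k) - (\<Sum>i<k. \<phi> i * r ^ (n + m * i))" for r
    by (simp add: p_alt power_add algebra_simps sum_distrib_left)
  ultimately show ?thesis
    by (simp add: int \<gamma> integral_sum)
qed

lemma Berger_measure_powers_integrable_nonneg:
  assumes "Berger_measure \<omega> \<sigma>"
  shows "integrable \<sigma> (\<lambda>r. r ^ k)" and "\<And>r. r \<in> space \<sigma> \<Longrightarrow> 0 \<le> r"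
proof -
  define c where "c = (onorm (weighted_shift \<omega>))\<^sup>2"
  have sets: "sets \<sigma> = sets (restrict_space borel {0..c})"
    using assms by (simp add: Berger_measure_def c_def)
  have space: "space \<sigma> = {0..c}"
    using sets_eq_imp_space_eq[OF sets] by (simp add: space_restrict_space)
  then show "0 \<le> r" if "r \<in> space \<sigma>" for r using that by simp
  interpret prob_space \<sigma> using assms by (simp add: Berger_measure_def)
  have "(\<lambda>r. r ^ k) \<in> borel_measurable (restrict_space borel {0..c})"
    by (intro measurable_restrict_space1) measurable
  then have "(\<lambda>r. r ^ k) \<in> borel_measurable \<sigma>"
    using measurable_cong_sets[OF sets refl] by blast
  then show "integrable \<sigma> (\<lambda>r. r ^ k)"
    by (rule integrable_const_bound[where B = "c ^ k", rotated])
      (auto intro!: power_mono simp: space power_abs)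
qed

section \<open>Recursive generation passes from the power to the shift\<close>

theorem theorem1p10:
  fixes m :: nat
    and \<omega> :: "nat \<Rightarrow> real"
    and \<alpha> :: "'j \<Rightarrow> nat \<Rightarrow> real"
    and S :: "('j \<times> nat) ell2 \<Rightarrow> ('j \<times> nat) ell2"
  assumes "m \<ge> 1"
    and "subnormal_shift \<omega>"
    and "\<And>j. recursively_generated_shift (\<alpha> j)"
    and "is_direct_sum S (\<lambda>j. weighted_shift (\<alpha> j))"
    and "unitarily_equivalent (weighted_shift \<omega> ^^ m) S"
  shows "recursively_generated_shift \<omega>"
proof -
  obtain \<sigma> where \<omega>: "shift_weights \<omega>" and \<sigma>: "Berger_measure \<omega> \<sigma>"
    using assms(2) by (auto simp: subnormal_shift_def)
  have \<alpha>: "shift_weights (\<alpha> j)" for j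
    using assms(3)[of j] by (simp add: recursively_generated_shift_def subnormal_shift_def)
  obtain j w where w: "\<And>i. 0 \<le> w i" "0 < w 0"
    and a: "\<And>n. moment (\<alpha> j) n = (\<Sum>i<m. w i * moment \<omega> (i + m * n))"
    by (rule summand_moments[OF assms(1) \<omega> \<alpha> assms(4,5)]) (rule that)
  obtain k \<phi> where k: "k \<ge> 1"
    and rec: "\<And>n. moment (\<alpha> j) (n + k) = (\<Sum>i<k. \<phi> i * moment (\<alpha> j) (n + i))"
    using assms(3)[of j] unfolding recursively_generated_shift_def by blast
  have \<gamma>: "moment \<omega> k = (LINT r|\<sigma>. r ^ k)" for k
    using \<sigma> by (simp add: Berger_measure_def)
  note lift = moments_recurrence_lift[OF Berger_measure_powers_integrable_nonneg(2)[OF \<sigma>]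
      Berger_measure_powers_integrable_nonneg(1)[OF \<sigma>] \<gamma> assms(1) w a rec]
  \<comment> \<open>The lifted recurrence involves only the shifts by multiples of \<open>m\<close>; the coefficients in
    between are zero.\<close>
  define \<psi> where "\<psi> l = (if m dvd l then \<phi> (l div m) else 0)" for l
  have "moment \<omega> (n + m * k) = (\<Sum>l<m * k. \<psi> l * moment \<omega> (n + l))" for n
  proof -
    have "(\<Sum>l<m * k. \<psi> l * moment \<omega> (n + l)) =
        (\<Sum>l\<in>(\<lambda>i. m * i) ` {..<k}. \<psi> l * moment \<omega> (n + l))"
      using assms(1) by (intro sum.mono_neutral_right) (auto simp: \<psi>_def)
    also have "\<dots> = (\<Sum>i<k. \<phi> i * moment \<omega> (n + m * i))"
      using assms(1) by (subst sum.reindex) (auto simp: inj_on_def \<psi>_def)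
    finally show ?thesis by (simp add: lift)
  qed
  moreover have "m * k \<ge> 1" using assms(1) k by simp
  ultimately show ?thesis
    using assms(2) unfolding recursively_generated_shift_def by blast
qed

end
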